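(* Let $\Omega\subset\mathbb{R}^n$, $n\ge 2$, be a bounded domain, and let $g\in C(\mathbb{R},\mathbb{R})$ be such that there exists $s_0\ge 0$ with $g\ge 0$ on $[s_0,\infty)$ and $g\le 0$ on $(-\infty,-s_0]$. Put $G(t)=\int_0^t g(\tau)\,d\tau$. Let $\bar f\in C(\mathbb{R},\mathbb{R})$ be such that $t\mapsto \bar f(t)\,\mathrm{e}^{3G(t)}$ is a non-increasing function on $\mathbb{R}$, and let $c\in\mathbb{R}$ be a constant. Then the Dirichlet problem $$\Delta_\infty u+g(u)|Du|^4+\bar f(u)=0\ \text{ in }\Omega,\qquad u=c\ \text{ on }\partial\Omega$$ has at most one viscosity solution $u\in C(\overline\Omega)$.
   Context: The infinity-Laplacian is $\Delta_\infty u=\langle D^2u\,Du,Du\rangle$. A function $u\in C(\overline\Omega)$ is a viscosity solution of the Dirichlet problem if $u=c$ on $\partial\Omega$ and the following two conditions hold. Subsolution: whenever $\varphi\in C^2(\Omega)$ and $u-\varphi$ has a local maximum at $x_0\in\Omega$, then $\langle D^2\varphi(x_0)D\varphi(x_0),D\varphi(x_0)\rangle+g(u(x_0))|D\varphi(x_0)|^4+\bar f(u(x_0))\ge 0$. Supersolution: whenever $\varphi\in C^2(\Omega)$ and $u-\varphi$ has a local minimum at $x_0\in\Omega$, then $\langle D^2\varphi(x_0)D\varphi(x_0),D\varphi(x_0)\rangle+g(u(x_0))|D\varphi(x_0)|^4+\bar f(u(x_0))\le 0$. *)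

theory Defs
  imports "HOL-Analysis.Analysis"
begin

definition grad :: "(real ^ 'n \<Rightarrow> real) \<Rightarrow> real ^ 'n \<Rightarrow> real ^ 'n" where
  "grad \<phi> x = (\<chi> i. frechet_derivative \<phi> (at x) (axis i 1))"

definition hess :: "(real ^ 'n \<Rightarrow> real) \<Rightarrow> real ^ 'n \<Rightarrow> real ^ 'n ^ 'n" where
  "hess \<phi> x = jacobian (grad \<phi>) (at x)"

(* Intended for open \<Omega>, where the total derivatives at the points of \<Omega> depend only on
   the values of \<phi> on \<Omega>. *)
definition C2_on :: "(real ^ 'n) set \<Rightarrow> (real ^ 'n \<Rightarrow> real) \<Rightarrow> bool" where
  "C2_on \<Omega> \<phi> \<longleftrightarrow>
     (\<forall>x\<in>\<Omega>. \<phi> differentiable (at x)) \<and>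
     (\<forall>x\<in>\<Omega>. grad \<phi> differentiable (at x)) \<and>
     continuous_on \<Omega> (hess \<phi>)"

definition inf_laplacian :: "(real ^ 'n \<Rightarrow> real) \<Rightarrow> real ^ 'n \<Rightarrow> real" where
  "inf_laplacian \<phi> x = (hess \<phi> x *v grad \<phi> x) \<bullet> grad \<phi> x"

definition local_max_in :: "(real ^ 'n) set \<Rightarrow> (real ^ 'n \<Rightarrow> real) \<Rightarrow> real ^ 'n \<Rightarrow> bool" where
  "local_max_in \<Omega> w x0 \<longleftrightarrow> x0 \<in> \<Omega> \<and> (\<forall>\<^sub>F x in at x0 within \<Omega>. w x \<le> w x0)"

definition local_min_in :: "(real ^ 'n) set \<Rightarrow> (real ^ 'n \<Rightarrow> real) \<Rightarrow> real ^ 'n \<Rightarrow> bool" where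
  "local_min_in \<Omega> w x0 \<longleftrightarrow> x0 \<in> \<Omega> \<and> (\<forall>\<^sub>F x in at x0 within \<Omega>. w x0 \<le> w x)"

definition viscosity_subsolution ::
  "(real \<Rightarrow> real) \<Rightarrow> (real \<Rightarrow> real) \<Rightarrow> (real ^ 'n) set \<Rightarrow> (real ^ 'n \<Rightarrow> real) \<Rightarrow> bool" where
  "viscosity_subsolution g f \<Omega> u \<longleftrightarrow>
     (\<forall>\<phi> x0. C2_on \<Omega> \<phi> \<longrightarrow> local_max_in \<Omega> (\<lambda>x. u x - \<phi> x) x0 \<longrightarrow>
        inf_laplacian \<phi> x0 + g (u x0) * norm (grad \<phi> x0) ^ 4 + f (u x0) \<ge> 0)"

definition viscosity_supersolution ::
  "(real \<Rightarrow> real) \<Rightarrow> (real \<Rightarrow> real) \<Rightarrow> (real ^ 'n) set \<Rightarrow> (real ^ 'n \<Rightarrow> real) \<Rightarrow> bool" where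
  "viscosity_supersolution g f \<Omega> u \<longleftrightarrow>
     (\<forall>\<phi> x0. C2_on \<Omega> \<phi> \<longrightarrow> local_min_in \<Omega> (\<lambda>x. u x - \<phi> x) x0 \<longrightarrow>
        inf_laplacian \<phi> x0 + g (u x0) * norm (grad \<phi> x0) ^ 4 + f (u x0) \<le> 0)"

(* Only the values of u on closure \<Omega> matter; u is an arbitrary total extension of an
   element of C(closure \<Omega>). *)
definition dirichlet_viscosity_solution ::
  "(real \<Rightarrow> real) \<Rightarrow> (real \<Rightarrow> real) \<Rightarrow> real \<Rightarrow> (real ^ 'n) set \<Rightarrow> (real ^ 'n \<Rightarrow> real) \<Rightarrow> bool" where
  "dirichlet_viscosity_solution g f c \<Omega> u \<longleftrightarrow>
     continuous_on (closure \<Omega>) u \<and>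
     (\<forall>x\<in>frontier \<Omega>. u x = c) \<and>
     viscosity_subsolution g f \<Omega> u \<and>
     viscosity_supersolution g f \<Omega> u"

(* The interval integral is oriented, so for t < 0 this is minus the integral over [t, 0]. *)
definition primitive0 :: "(real \<Rightarrow> real) \<Rightarrow> real \<Rightarrow> real" where
  "primitive0 g t = (LBINT \<tau>=ereal 0..ereal t. g \<tau>)"

end

(* With G' = g, E = exp G and \<Phi>' = E, the function W = \<Phi>(u) solves \<Delta>_\<infinity> W = h(W) in the viscosity
   sense, where h(\<Phi>(t)) = - f(t) E(t)^3 is nondecreasing.  By symmetry let h(\<Phi>(c)) \<ge> 0.  Then
   W \<le> \<Phi>(c), and if two solutions U and -V satisfy U + V > 0 at a point, then h(U) > 0 there.
   Hence stretching U away from \<Phi>(c) by a factor \<mu> > 1 makes it a strict subsolution without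
   changing the boundary values.

   The strict comparison needs no theorem on sums.  Maximize U(y) + V(z) under |y - z| \<le> 2\<epsilon> and
   let x be the midpoint of a maximizing pair.  Every point within 2\<epsilon> of x forms an admissible pair
   with x, which bounds the maxima of U and V over the ball of radius 2\<epsilon> about x.  Comparing U and V
   on this ball with the radial solutions K (r + \<tau>)^(4/3) and - K (2\<epsilon> + \<tau> - r)^(4/3), for which
   \<Delta>_\<infinity> is the constant 64/81 K^3, respectively - 64/81 K^3, contradicts these bounds.  This is the
   method of Armstrong and Smart with the cones replaced by 4/3-powers. *)

theory Submission
  imports Defs
begin

subsection \<open>Radial test functions\<close>

lemma grad_eq:
  assumes "(\<phi> has_derivative (\<lambda>h. d \<bullet> h)) (at x)"
  shows "grad \<phi> x = d"
proof -
  have "frechet_derivative \<phi> (at x) = (\<lambda>h. d \<bullet> h)"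
    using frechet_derivative_at[OF assms] by simp
  then show ?thesis
    unfolding grad_def by (simp add: vec_eq_iff inner_axis)
qed

lemma grad_inner:
  assumes "\<phi> differentiable (at x)"
  shows "(\<phi> has_derivative (\<lambda>h. grad \<phi> x \<bullet> h)) (at x)"
proof -
  let ?D = "frechet_derivative \<phi> (at x)"
  have D: "(\<phi> has_derivative ?D) (at x)"
    using assms frechet_derivative_works by blast
  then have "linear ?D"
    by (rule has_derivative_linear)
  then have "?D h = grad \<phi> x \<bullet> h" for h
  proof -
    have "?D h = ?D (\<Sum>i\<in>UNIV. (h $ i) *\<^sub>R axis i 1)"
      by (simp add: basis_expansion scalar_mult_eq_scaleR[symmetric])
    also have "\<dots> = (\<Sum>i\<in>UNIV. (h $ i) *\<^sub>R ?D (axis i 1))"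
      using \<open>linear ?D\<close> by (simp add: linear_sum linear_cmul)
    also have "\<dots> = grad \<phi> x \<bullet> h"
      by (simp add: grad_def inner_vec_def mult.commute)
    finally show ?thesis .
  qed
  then have "?D = (\<lambda>h. grad \<phi> x \<bullet> h)" by auto
  with D show ?thesis by simp
qed

lemma hess_eq:
  assumes "(grad \<phi> has_derivative D) (at x)"
  shows "hess \<phi> x = matrix D"
  using frechet_derivative_at[OF assms] by (simp add: hess_def jacobian_def)

text \<open>Test functions must be C^2 on all of \<Omega>, which a 4/3-power of a distance is not in
  general. A polynomial in |x - a|^2 is smooth everywhere, the centre included, and its two
  coefficients suffice to prescribe the first two derivatives in |x - a|^2 at the contact
  point.\<close>

lemma quadratic_profile_C2:
  fixes a :: "real ^ 'n" and k1 k2 s :: real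
  assumes q_def: "q = (\<lambda>x. (x - a) \<bullet> (x - a))"
    and \<phi>_def: "\<phi> = (\<lambda>x. k1 * (q x - s) + k2 / 2 * (q x - s)\<^sup>2)"
  shows "C2_on \<Omega> \<phi>"
    and "grad \<phi> = (\<lambda>x. (2 * (k1 + k2 * (q x - s))) *\<^sub>R (x - a))"
    and "hess \<phi> x *v h =
      (4 * k2 * ((x - a) \<bullet> h)) *\<^sub>R (x - a) + (2 * (k1 + k2 * (q x - s))) *\<^sub>R h"
proof -
  have Dq: "(q has_derivative (\<lambda>h. 2 * ((x - a) \<bullet> h))) (at x)" for x
    unfolding q_def by (auto intro!: derivative_eq_intros simp: fun_eq_iff inner_commute)
  have "(\<phi> has_derivative (\<lambda>h. (2 * (k1 + k2 * (q x - s))) * ((x - a) \<bullet> h))) (at x)" for x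
    unfolding \<phi>_def
    by (rule derivative_eq_intros Dq refl)+ (simp add: fun_eq_iff field_simps)
  then have D\<phi>: "(\<phi> has_derivative (\<lambda>h. ((2 * (k1 + k2 * (q x - s))) *\<^sub>R (x - a)) \<bullet> h)) (at x)" for x
    by simp
  show G: "grad \<phi> = (\<lambda>x. (2 * (k1 + k2 * (q x - s))) *\<^sub>R (x - a))"
    using grad_eq[OF D\<phi>] by auto
  define D where "D = (\<lambda>x h. (4 * k2 * ((x - a) \<bullet> h)) *\<^sub>R (x - a)
    + (2 * (k1 + k2 * (q x - s))) *\<^sub>R h)"
  have DG: "(grad \<phi> has_derivative D x) (at x)" for x
    unfolding G D_def
    by (rule derivative_eq_intros Dq refl)+ (simp add: fun_eq_iff algebra_simps)
  have H: "hess \<phi> x = matrix (D x)" for x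
    using hess_eq[OF DG] .
  have "linear (D x)" for x
    using DG has_derivative_linear by blast
  then show "hess \<phi> x *v h =
      (4 * k2 * ((x - a) \<bullet> h)) *\<^sub>R (x - a) + (2 * (k1 + k2 * (q x - s))) *\<^sub>R h"
    by (simp add: H matrix_works D_def)
  have "continuous_on \<Omega> (\<lambda>x. matrix (D x))"
    unfolding matrix_def D_def q_def
    by (intro continuous_on_vec_lambda continuous_intros)
  then show "C2_on \<Omega> \<phi>"
    unfolding C2_on_def using D\<phi> DG H by (auto simp: differentiable_def)
qed

text \<open>With w = x0 - a, the test function has at x0 the gradient 2 k1 w and the Hessian 4 k2 w
  w^T + 2 k1 I, and |w|^2 = s.\<close>

lemma viscosity_subsolution_quadratic_profile:
  fixes a x0 :: "real ^ 'n"
  assumes sub: "viscosity_subsolution g f \<Omega> u" and "x0 \<in> \<Omega>"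
    and le: "\<forall>\<^sub>F x in at x0 within \<Omega>. u x \<le> u x0 + k1 * ((norm (x - a))\<^sup>2 - s)
      + k2 / 2 * ((norm (x - a))\<^sup>2 - s)\<^sup>2"
    and s: "s = (norm (x0 - a))\<^sup>2"
  shows "8 * k1 ^ 3 * s + 16 * k1\<^sup>2 * k2 * s\<^sup>2 + g (u x0) * (16 * k1 ^ 4 * s\<^sup>2) + f (u x0) \<ge> 0"
proof -
  define q where "q = (\<lambda>x. (x - a) \<bullet> (x - a))"
  define \<phi> where "\<phi> = (\<lambda>x. k1 * (q x - s) + k2 / 2 * (q x - s)\<^sup>2)"
  note C2 = quadratic_profile_C2[OF q_def \<phi>_def]
  have q: "q x = (norm (x - a))\<^sup>2" for x
    by (simp add: q_def power2_norm_eq_inner)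
  have s': "q x0 = s" by (simp add: q s)
  have "local_max_in \<Omega> (\<lambda>x. u x - \<phi> x) x0"
    unfolding local_max_in_def
    using le \<open>x0 \<in> \<Omega>\<close> by (auto simp: \<phi>_def s' q[symmetric] elim!: eventually_mono)
  then have "inf_laplacian \<phi> x0 + g (u x0) * norm (grad \<phi> x0) ^ 4 + f (u x0) \<ge> 0"
    using sub C2(1) by (auto simp: viscosity_subsolution_def)
  moreover have in0: "(x0 - a) \<bullet> (x0 - a) = s"
    using s' by (simp add: q_def)
  have "inf_laplacian \<phi> x0 = 8 * k1 ^ 3 * s + 16 * k1\<^sup>2 * k2 * s\<^sup>2"
  proof -
    define w where "w = x0 - a"
    have "w \<bullet> w = s" using in0 by (simp add: w_def)
    then show ?thesis
      unfolding inf_laplacian_def C2(3) C2(2) s' w_def[symmetric]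
      by (simp add: inner_add_left power2_eq_square power3_eq_cube algebra_simps)
  qed
  moreover have "norm (grad \<phi> x0) ^ 4 = ((norm (grad \<phi> x0))\<^sup>2)\<^sup>2"
    by simp
  then have "norm (grad \<phi> x0) ^ 4 = 16 * k1 ^ 4 * s\<^sup>2"
    unfolding C2(2) s' by (simp add: power_mult_distrib flip: s)
  ultimately show ?thesis by simp
qed

text \<open>The infinity-Laplacian is odd in the test function and the fourth power of the gradient
  norm is even, so the sign change is absorbed by reflecting \<open>g\<close> and \<open>f\<close>.
  Supersolutions are thereby reduced to subsolutions.\<close>

lemma viscosity_supersolution_uminus:
  assumes sup: "viscosity_supersolution g f \<Omega> v" and "open \<Omega>"
  shows "viscosity_subsolution (\<lambda>t. - g (- t)) (\<lambda>t. - f (- t)) \<Omega> (\<lambda>x. - v x)"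
  unfolding viscosity_subsolution_def
proof (intro allI impI)
  fix \<phi> x0
  assume C2: "C2_on \<Omega> \<phi>" and lm: "local_max_in \<Omega> (\<lambda>x. - v x - \<phi> x) x0"
  let ?m = "\<lambda>x. - \<phi> x"
  have G: "(?m has_derivative (\<lambda>h. (- grad \<phi> x) \<bullet> h)) (at x)" if "x \<in> \<Omega>" for x
    using C2 that has_derivative_minus[OF grad_inner, of \<phi> x]
    by (auto simp: C2_on_def)
  then have g: "grad ?m x = - grad \<phi> x" if "x \<in> \<Omega>" for x
    using that grad_eq by blast
  \<comment> \<open>The formula for the gradient is known only on \<Omega>; openness permits
    differentiating it once more.\<close>
  have DG: "(grad ?m has_derivative (\<lambda>h. - frechet_derivative (grad \<phi>) (at x) h)) (at x)"
    if "x \<in> \<Omega>" for x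
  proof (rule has_derivative_transform_within_open[OF _ \<open>open \<Omega>\<close> that])
    show "((\<lambda>x. - grad \<phi> x) has_derivative
        (\<lambda>h. - frechet_derivative (grad \<phi>) (at x) h)) (at x)"
      using C2 that by (auto simp: C2_on_def frechet_derivative_works[symmetric]
        intro!: has_derivative_minus)
  qed (simp add: g)
  have h: "hess ?m x = - hess \<phi> x" if "x \<in> \<Omega>" for x
    unfolding hess_eq[OF DG[OF that]]
    by (simp add: hess_def jacobian_def matrix_def vec_eq_iff)
  have "continuous_on \<Omega> (hess ?m)"
    using C2 by (auto simp: C2_on_def h cong: continuous_on_cong intro!: continuous_on_minus)
  then have "C2_on \<Omega> ?m"
    using G DG by (auto simp: C2_on_def differentiable_def)
  moreover have x0: "x0 \<in> \<Omega>" and "local_min_in \<Omega> (\<lambda>x. v x - ?m x) x0"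
    using lm by (auto simp: local_max_in_def local_min_in_def elim!: eventually_mono)
  ultimately have "inf_laplacian ?m x0 + g (v x0) * norm (grad ?m x0) ^ 4 + f (v x0) \<le> 0"
    using sup by (auto simp: viscosity_supersolution_def)
  moreover have "inf_laplacian ?m x0 = - inf_laplacian \<phi> x0"
    by (simp add: inf_laplacian_def g[OF x0] h[OF x0] matrix_vector_mult_def inner_vec_def sum_negf)
  ultimately show "inf_laplacian \<phi> x0 + - g (- (- v x0)) * norm (grad \<phi> x0) ^ 4
      + - f (- (- v x0)) \<ge> 0"
    by (simp add: g[OF x0])
qed

section \<open>Change of the unknown and passage to radial test functions\<close>

text \<open>A positive derivative of \<open>F'\<close> at \<open>s0\<close> gives \<open>F'\<close>
  the sign of s - s0 nearby, and the mean value theorem turns this into a minimum of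
  \<open>F\<close>.\<close>

lemma second_derivative_local_min:
  fixes F :: "real \<Rightarrow> real"
  assumes F: "\<forall>\<^sub>F s in nhds s0. (F has_real_derivative F' s) (at s)"
    and F': "(F' has_real_derivative l) (at s0)" and "F' s0 = 0" "l > 0"
  shows "\<forall>\<^sub>F s in nhds s0. F s0 \<le> F s"
proof -
  obtain d1 where "d1 > 0" and d1: "\<And>s. dist s s0 < d1 \<Longrightarrow> (F has_real_derivative F' s) (at s)"
    using F by (auto simp: eventually_nhds_metric)
  obtain d2 where "d2 > 0" and d2: "\<And>h. 0 < h \<Longrightarrow> h < d2 \<Longrightarrow> F' s0 < F' (s0 + h)"
    using DERIV_pos_inc_right[OF F' \<open>l > 0\<close>] by auto
  obtain d3 where "d3 > 0" and d3: "\<And>h. 0 < h \<Longrightarrow> h < d3 \<Longrightarrow> F' (s0 - h) < F' s0"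
    using DERIV_pos_inc_left[OF F' \<open>l > 0\<close>] by auto
  define d where "d = min d1 (min d2 d3)"
  have "d > 0" using \<open>d1 > 0\<close> \<open>d2 > 0\<close> \<open>d3 > 0\<close> by (simp add: d_def)
  moreover have "F s0 \<le> F s" if s: "dist s s0 < d" for s
  proof (cases s s0 rule: linorder_cases)
    case less
    have "\<exists>z>s. z < s0 \<and> F s0 - F s = (s0 - s) * F' z"
      using less s by (intro MVT2 d1) (auto simp: d_def dist_real_def)
    then obtain z where z: "s < z" "z < s0" "F s0 - F s = (s0 - s) * F' z" by blast
    have "F' z \<le> 0"
      using d3[of "s0 - z"] z s \<open>F' s0 = 0\<close> by (auto simp: d_def dist_real_def)
    then have "(s0 - s) * F' z \<le> 0"
      using less by (simp add: mult_nonneg_nonpos)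
    then show ?thesis using z by simp
  next
    case greater
    have "\<exists>z>s0. z < s \<and> F s - F s0 = (s - s0) * F' z"
      using greater s by (intro MVT2 d1) (auto simp: d_def dist_real_def)
    then obtain z where z: "s0 < z" "z < s" "F s - F s0 = (s - s0) * F' z" by blast
    have "F' z \<ge> 0"
      using d2[of "z - s0"] z s \<open>F' s0 = 0\<close> by (auto simp: d_def dist_real_def)
    then have "(s - s0) * F' z \<ge> 0"
      using greater by simp
    then show ?thesis using z by simp
  qed simp
  ultimately show ?thesis
    by (auto simp: eventually_nhds_metric)
qed

text \<open>Viscosity subsolutions of $\Delta_\infty W = h(W)$, tested only with the radial functions
  $\kappa (\sigma |x - a| + \tau)^{4/3}$, whose infinity-Laplacian is the constant
  $\frac{64}{81} \kappa^3$; $\kappa = 0$ gives the constant test functions.\<close>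

definition radial_sub :: "(real \<Rightarrow> real) \<Rightarrow> (real ^ 'n) set \<Rightarrow> (real ^ 'n \<Rightarrow> real) \<Rightarrow> bool" where
  "radial_sub h \<Omega> W \<longleftrightarrow>
     (\<forall>x0 a \<kappa> \<sigma> \<tau>. \<bar>\<sigma>\<bar> = 1 \<longrightarrow> a \<noteq> x0 \<longrightarrow> 0 < \<sigma> * dist x0 a + \<tau> \<longrightarrow>
        local_max_in \<Omega> (\<lambda>x. W x - \<kappa> * (\<sigma> * dist x a + \<tau>) powr (4/3)) x0 \<longrightarrow>
        h (W x0) \<le> 64 / 81 * \<kappa> ^ 3)"

text \<open>For smooth u, E' = g E gives that the infinity-Laplacian of \<Phi>(u) is E(u)^3 times
  that of u plus g(u) |Du|^4. The viscosity version works in the variable s = |x - a|^2, where the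
  available test functions are quadratic.\<close>

lemma viscosity_subsolution_radial_sub:
  fixes \<Omega> :: "(real ^ 'n) set"
  assumes sub: "viscosity_subsolution g f \<Omega> u"
    and \<Phi>: "\<And>t. (\<Phi> has_real_derivative E t) (at t)"
    and E: "\<And>t. (E has_real_derivative g t * E t) (at t)" and Epos: "\<And>t. E t > 0"
    and h: "\<And>t. h (\<Phi> t) = - f t * E t ^ 3"
  shows "radial_sub h \<Omega> (\<lambda>x. \<Phi> (u x))"
  unfolding radial_sub_def
proof (intro allI impI)
  fix x0 a :: "real ^ 'n" and \<kappa> \<sigma> \<tau> :: real
  assume \<sigma>: "\<bar>\<sigma>\<bar> = 1" and "a \<noteq> x0" and b0: "0 < \<sigma> * dist x0 a + \<tau>"
    and lm: "local_max_in \<Omega> (\<lambda>x. \<Phi> (u x) - \<kappa> * (\<sigma> * dist x a + \<tau>) powr (4/3)) x0"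
  define r where "r = dist x0 a"
  define b where "b = \<sigma> * r + \<tau>"
  define s0 where "s0 = r\<^sup>2"
  define e where "e = E (u x0)"
  define \<gamma> where "\<gamma> = g (u x0)"
  define \<psi> where "\<psi> = (\<lambda>s. \<kappa> * (\<sigma> * sqrt s + \<tau>) powr (4/3))"
  define \<psi>' where "\<psi>' = (\<lambda>s. \<kappa> * (4/3) * (\<sigma> * sqrt s + \<tau>) powr (1/3) * \<sigma> / (2 * sqrt s))"
  define \<psi>2 where "\<psi>2 = \<kappa> * (4/3) * (1/3 * b powr (-2/3) * (\<sigma> / (2 * r))\<^sup>2
     - b powr (1/3) * \<sigma> / (4 * r ^ 3))"
  have x0: "x0 \<in> \<Omega>" using lm by (simp add: local_max_in_def)
  have "r > 0" using \<open>a \<noteq> x0\<close> by (simp add: r_def)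
  have "b > 0" using b0 by (simp add: b_def r_def)
  have "s0 > 0" using \<open>r > 0\<close> by (simp add: s0_def)
  have sq: "sqrt s0 = r" using \<open>r > 0\<close> by (simp add: s0_def)
  have "e > 0" by (simp add: e_def Epos)
  have \<sigma>2: "\<sigma>\<^sup>2 = 1" using \<sigma> by (metis abs_square_eq_1)
  have "\<forall>\<^sub>F s in nhds s0. s > 0 \<and> \<sigma> * sqrt s + \<tau> > 0"
  proof -
    have "((\<lambda>s. \<sigma> * sqrt s + \<tau>) \<longlongrightarrow> b) (nhds s0)"
      unfolding b_def sq[symmetric] by (auto intro!: tendsto_intros filterlim_ident)
    then have "\<forall>\<^sub>F s in nhds s0. \<sigma> * sqrt s + \<tau> > 0"
      using \<open>b > 0\<close> order_tendstoD(1) by blast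
    moreover have "\<forall>\<^sub>F s in nhds s0. s > 0"
      using \<open>s0 > 0\<close> eventually_nhds_in_open[of "{0<..}" s0] by auto
    ultimately show ?thesis by eventually_elim auto
  qed
  then have D\<psi>: "\<forall>\<^sub>F s in nhds s0. (\<psi> has_real_derivative \<psi>' s) (at s)"
  proof eventually_elim
    case (elim s)
    then show ?case
      unfolding \<psi>_def \<psi>'_def
      by (auto intro!: derivative_eq_intros simp: field_simps)
  qed
  have "(\<sigma> * sqrt s0 + \<tau>) = b" by (simp add: sq b_def)
  then have D\<psi>': "(\<psi>' has_real_derivative \<psi>2) (at s0)"
    unfolding \<psi>'_def \<psi>2_def using \<open>s0 > 0\<close> \<open>b > 0\<close> \<open>r > 0\<close>
    by (auto intro!: derivative_eq_intros)
      (simp add: sq field_simps s0_def power2_eq_square power3_eq_cube)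
  \<comment> \<open>Formally, u is tested with the inverse of \<Phi> applied to \<psi> plus a
    constant. The first two derivatives of this composition at \<open>s0\<close> are
    \<open>k1\<close> and \<open>(\<psi>2 - \<gamma> * e * k1\<^sup>2) / e\<close>. The slack \<eta>
    makes the touching strict to second order.\<close>
  define k1 where "k1 = \<psi>' s0 / e"
  have main: "8 * k1 ^ 3 * s0 + 16 * k1\<^sup>2 * ((\<psi>2 - \<gamma> * e * k1\<^sup>2) / e + \<eta>) * s0\<^sup>2
      + \<gamma> * (16 * k1 ^ 4 * s0\<^sup>2) + f (u x0) \<ge> 0" if "\<eta> > 0" for \<eta>
  proof -
    define k2 where "k2 = (\<psi>2 - \<gamma> * e * k1\<^sup>2) / e + \<eta>"
    \<comment> \<open>\<open>p\<close> is chosen such that \<open>\<Phi> \<circ> p\<close> has, up to an additive constant, first-order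
      contact with \<open>\<psi>\<close> at \<open>s0\<close> and lies above it nearby; so \<open>p (|x - a|\<^sup>2)\<close> touches \<open>u\<close> from above.\<close>
    define p where "p = (\<lambda>s. u x0 + k1 * (s - s0) + k2 / 2 * (s - s0)\<^sup>2)"
    define F where "F = (\<lambda>s. \<Phi> (p s) - \<psi> s)"
    define F' where "F' = (\<lambda>s. E (p s) * (k1 + k2 * (s - s0)) - \<psi>' s)"
    have Dp: "(p has_real_derivative k1 + k2 * (s - s0)) (at s)" for s
      unfolding p_def by (auto intro!: derivative_eq_intros)
    have p0: "p s0 = u x0" by (simp add: p_def)
    have "\<forall>\<^sub>F s in nhds s0. F s0 \<le> F s"
    proof (rule second_derivative_local_min)
      show "\<forall>\<^sub>F s in nhds s0. (F has_real_derivative F' s) (at s)"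
        using D\<psi>
      proof eventually_elim
        case (elim s)
        show ?case unfolding F_def F'_def
          by (intro DERIV_diff elim DERIV_chain2[OF \<Phi> Dp])
      qed
      have "(F' has_real_derivative (\<gamma> * e * (k1 + k2 * (s0 - s0)) * (k1 + k2 * (s0 - s0))
          + e * k2 - \<psi>2)) (at s0)"
        unfolding F'_def
        by (auto intro!: derivative_eq_intros DERIV_chain2[OF E Dp] D\<psi>' simp: p0 e_def \<gamma>_def)
      moreover have "\<gamma> * e * (k1 + k2 * (s0 - s0)) * (k1 + k2 * (s0 - s0)) + e * k2 - \<psi>2 = e * \<eta>"
        using \<open>e > 0\<close> by (simp add: k2_def field_simps power2_eq_square)
      ultimately show "(F' has_real_derivative e * \<eta>) (at s0)" by simp
      show "F' s0 = 0"
        using \<open>e > 0\<close> by (simp add: F'_def p0 k1_def flip: e_def)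
      show "e * \<eta> > 0" using \<open>e > 0\<close> \<open>\<eta> > 0\<close> by simp
    qed
    moreover have "((\<lambda>x. (norm (x - a))\<^sup>2) \<longlongrightarrow> s0) (at x0 within \<Omega>)"
      unfolding s0_def r_def dist_norm by (intro tendsto_intros)
    ultimately have ev: "\<forall>\<^sub>F x in at x0 within \<Omega>. F s0 \<le> F ((norm (x - a))\<^sup>2)"
      by (rule eventually_compose_filterlim)
    have mono: "t \<le> t'" if "\<Phi> t \<le> \<Phi> t'" for t t'
    proof (rule ccontr)
      assume "\<not> t \<le> t'"
      then have "\<Phi> t' < \<Phi> t"
        using \<Phi> Epos by (intro DERIV_pos_imp_increasing[of t' t \<Phi>]) auto
      with that show False by simp
    qed
    have "\<forall>\<^sub>F x in at x0 within \<Omega>. \<Phi> (u x) - \<kappa> * (\<sigma> * dist x a + \<tau>) powr (4/3)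
      \<le> \<Phi> (u x0) - \<kappa> * (\<sigma> * dist x0 a + \<tau>) powr (4/3)"
      using lm by (simp add: local_max_in_def)
    then have "\<forall>\<^sub>F x in at x0 within \<Omega>. u x \<le> u x0 + k1 * ((norm (x - a))\<^sup>2 - s0)
      + k2 / 2 * ((norm (x - a))\<^sup>2 - s0)\<^sup>2"
      using ev
    proof eventually_elim
      case (elim x)
      then have "\<Phi> (u x) \<le> \<Phi> (p ((norm (x - a))\<^sup>2))"
        by (simp add: F_def p0 \<psi>_def sq dist_norm r_def)
      then show ?case
        using mono by (simp add: p_def)
    qed
    from viscosity_subsolution_quadratic_profile[OF sub x0 this]
    show ?thesis
      by (simp add: s0_def r_def dist_norm k2_def \<gamma>_def)
  qed
  \<comment> \<open>The inequality depends continuously on the slack, which is now sent to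
    0.\<close>
  define L where "L = (\<lambda>\<eta>. 8 * k1 ^ 3 * s0 + 16 * k1\<^sup>2 * ((\<psi>2 - \<gamma> * e * k1\<^sup>2) / e + \<eta>) * s0\<^sup>2
      + \<gamma> * (16 * k1 ^ 4 * s0\<^sup>2) + f (u x0))"
  have "(L \<longlongrightarrow> L 0) (at_right 0)"
    unfolding L_def by (intro tendsto_intros)
  moreover have "\<forall>\<^sub>F \<eta> in at_right 0. 0 \<le> L \<eta>"
    using main by (auto simp: L_def eventually_at_right_less intro!: eventually_at_rightI[of 0 1])
  ultimately have "0 \<le> L 0"
    by (rule tendsto_lowerbound) simp
  \<comment> \<open>The factor e^3 clears the denominators of k1 = \<psi>'(s0) / e, and the two
    terms with \<gamma> cancel.\<close>
  then have "0 \<le> e ^ 3 * L 0" using \<open>e > 0\<close> by simp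
  also have "e ^ 3 * L 0 = 16 * s0\<^sup>2 * (\<psi>' s0)\<^sup>2 * (\<psi>2 + \<psi>' s0 / (2 * s0)) + f (u x0) * e ^ 3"
    using \<open>e > 0\<close> \<open>s0 > 0\<close> unfolding L_def k1_def
    by (simp add: field_simps power2_eq_square power3_eq_cube power4_eq_xxxx)
  \<comment> \<open>Undoing s = r^2, with w(r) = \<kappa> (\<sigma> r + \<tau>)^(4/3), the left side
    is w'(r)^2 w''(r). Here w' is a multiple of the 1/3-power and w'' of the (-2/3)-power, so the
    powers cancel.\<close>
  also have "16 * s0\<^sup>2 * (\<psi>' s0)\<^sup>2 * (\<psi>2 + \<psi>' s0 / (2 * s0)) = 64 / 81 * \<kappa> ^ 3"
  proof -
    define \<beta> where "\<beta> = b powr (1/3)"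
    have "\<beta> > 0" using \<open>b > 0\<close> by (simp add: \<beta>_def)
    have "b powr (-2/3) * (\<beta> * \<beta>) = 1"
      using \<open>b > 0\<close> unfolding \<beta>_def by (simp flip: powr_add)
    then have \<beta>2: "b powr (-2/3) = 1 / (\<beta> * \<beta>)"
      using \<open>\<beta> > 0\<close> by (simp add: field_simps)
    have \<psi>'0: "\<psi>' s0 = \<kappa> * (4/3) * \<beta> * \<sigma> / (2 * r)"
      by (simp add: \<psi>'_def sq \<beta>_def b_def)
    have \<psi>'sq: "(\<psi>' s0)\<^sup>2 = 4 / 9 * \<kappa>\<^sup>2 * \<beta>\<^sup>2 / r\<^sup>2"
      unfolding \<psi>'0 by (simp add: power_divide power_mult_distrib \<sigma>2)
    have "\<psi>2 + \<psi>' s0 / (2 * s0) = \<kappa> * (4/9) * \<sigma>\<^sup>2 / (\<beta>\<^sup>2 * (4 * r\<^sup>2))"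
      unfolding \<psi>2_def \<psi>'0 \<beta>2 \<beta>_def[symmetric] unfolding s0_def using \<open>r > 0\<close> \<open>\<beta> > 0\<close>
      by (simp add: field_simps power2_eq_square power3_eq_cube)
    then have sum: "\<psi>2 + \<psi>' s0 / (2 * s0) = \<kappa> / 9 / (\<beta>\<^sup>2 * r\<^sup>2)"
      by (simp add: \<sigma>2)
    show ?thesis
      unfolding sum \<psi>'sq unfolding s0_def using \<open>r > 0\<close> \<open>\<beta> > 0\<close>
      by (simp add: field_simps power2_eq_square power3_eq_cube)
  qed
  finally show "h (\<Phi> (u x0)) \<le> 64 / 81 * \<kappa> ^ 3"
    by (simp add: h e_def)
qed

subsection \<open>Comparison with radial solutions\<close>

lemma radial_subD:
  assumes "radial_sub h \<Omega> W" "\<bar>\<sigma>\<bar> = 1" "a \<noteq> x0" "0 < \<sigma> * dist x0 a + \<tau>"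
    "open N" "x0 \<in> N" "N \<subseteq> \<Omega>"
    "\<And>x. x \<in> N \<Longrightarrow> W x - \<kappa> * (\<sigma> * dist x a + \<tau>) powr (4/3)
      \<le> W x0 - \<kappa> * (\<sigma> * dist x0 a + \<tau>) powr (4/3)"
  shows "h (W x0) \<le> 64 / 81 * \<kappa> ^ 3"
proof -
  have "\<forall>\<^sub>F x in at x0 within \<Omega>. x \<in> N"
    using assms by (auto simp: eventually_at_topological)
  then have "local_max_in \<Omega> (\<lambda>x. W x - \<kappa> * (\<sigma> * dist x a + \<tau>) powr (4/3)) x0"
    unfolding local_max_in_def using assms by (auto elim!: eventually_mono)
  then show ?thesis
    using assms unfolding radial_sub_def by blast
qed

text \<open>A maximum principle. Since h is only nonnegative above the level m, a small radial term
  is added to W; at an interior maximum the matching test function has a strictly negative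
  infinity-Laplacian.\<close>

lemma radial_sub_le:
  fixes \<Omega> :: "(real ^ 'n) set"
  assumes "open \<Omega>" "bounded \<Omega>" and cont: "continuous_on UNIV W"
    and out: "\<And>x. x \<notin> \<Omega> \<Longrightarrow> W x \<le> m"
    and sub: "radial_sub h \<Omega> W"
    and h: "\<And>x. W x \<ge> m \<Longrightarrow> h (W x) \<ge> 0"
  shows "W x \<le> m"
proof (rule ccontr)
  assume "\<not> W x \<le> m"
  then have Wx: "m < W x" by simp
  then have "x \<in> \<Omega>" using out by force
  \<comment> \<open>The centre lies off the closure and T exceeds all distances to it, so the radial
    test function is admissible at every point of \<Omega>.\<close>
  have "bounded (closure \<Omega>)" using \<open>bounded \<Omega>\<close> by (rule bounded_closure)
  then have "closure \<Omega> \<noteq> UNIV" using not_bounded_UNIV by metis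
  then obtain a where a: "a \<notin> closure \<Omega>" by blast
  obtain T' where "\<And>y. y \<in> closure \<Omega> \<Longrightarrow> dist a y \<le> T'"
    using \<open>bounded (closure \<Omega>)\<close> bounded_any_center[of "closure \<Omega>" a] by blast
  then have T: "dist a y < T' + 1" if "y \<in> closure \<Omega>" for y
    using that by force
  define T where "T = T' + 1"
  note T = T[folded T_def]
  have "x \<in> closure \<Omega>" using \<open>x \<in> \<Omega>\<close> closure_subset by auto
  then have "T > 0" using le_less_trans[OF zero_le_dist T] by blast
  \<comment> \<open>The added term is at most half the excess of W x over m, so the maximum point
    still satisfies W x0 > m.\<close>
  define K where "K = (W x - m) / 2 / T powr (4/3)"
  have "K > 0" using Wx \<open>T > 0\<close> by (simp add: K_def)
  have KT: "K * T powr (4/3) = (W x - m) / 2" using \<open>T > 0\<close> by (simp add: K_def)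
  define \<zeta> where "\<zeta> = (\<lambda>y. W y + K * (T - dist y a) powr (4/3))"
  have "compact (closure \<Omega>)" "closure \<Omega> \<noteq> {}"
    using \<open>bounded \<Omega>\<close> \<open>x \<in> \<Omega>\<close> by auto
  moreover have "continuous_on (closure \<Omega>) \<zeta>"
    unfolding \<zeta>_def using T
    by (intro continuous_intros continuous_on_powr' continuous_on_subset[OF cont])
      (auto simp: dist_commute less_imp_le)
  ultimately obtain x0 where x0: "x0 \<in> closure \<Omega>" "\<And>y. y \<in> closure \<Omega> \<Longrightarrow> \<zeta> y \<le> \<zeta> x0"
    using continuous_attains_sup by metis
  have "W x \<le> \<zeta> x" using \<open>K > 0\<close> by (simp add: \<zeta>_def)
  also have "\<dots> \<le> \<zeta> x0" using x0(2) \<open>x \<in> closure \<Omega>\<close> by blast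
  also have "\<dots> \<le> W x0 + K * T powr (4/3)"
    unfolding \<zeta>_def using \<open>K > 0\<close> T[OF x0(1)]
    by (intro add_left_mono mult_left_mono powr_mono2) (auto simp: dist_commute)
  finally have "m < W x0" using KT Wx by (simp add: field_simps)
  then have "x0 \<in> \<Omega>" using out by force
  have "h (W x0) \<le> 64 / 81 * (- K) ^ 3"
  proof (rule radial_subD[OF sub, where a = a and \<sigma> = "-1" and \<tau> = T and N = \<Omega>])
    show "0 < - 1 * dist x0 a + T" using T[OF x0(1)] by (simp add: dist_commute)
    fix y assume "y \<in> \<Omega>"
    then have "y \<in> closure \<Omega>" using closure_subset by auto
    from x0(2)[OF this]
    show "W y - - K * (- 1 * dist y a + T) powr (4/3) \<le> W x0 - - K * (- 1 * dist x0 a + T) powr (4/3)"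
      by (simp add: \<zeta>_def algebra_simps)
  qed (use \<open>x0 \<in> \<Omega>\<close> x0 a \<open>open \<Omega>\<close> in auto)
  also have "\<dots> < 0" using \<open>K > 0\<close> by simp
  finally show False using h[of x0] \<open>m < W x0\<close> by simp
qed

text \<open>The maximum of U minus the radial profile cannot lie in the punctured open ball, where
  testing would contradict \<open>h\<close>. It is therefore at the centre or on the sphere, and
  \<open>bd\<close> compares the sphere with the centre.\<close>

lemma radial_comparison_convex:
  fixes U :: "real ^ 'n \<Rightarrow> real"
  assumes sub: "radial_sub h \<Omega> U" and cont: "continuous_on UNIV U"
    and ball: "cball a r \<subseteq> \<Omega>" and "r > 0"
    and h: "\<And>x. x \<in> ball a r \<Longrightarrow> 64 / 81 * K ^ 3 < h (U x)"
    and "\<tau> \<ge> 0"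
    and bd: "\<And>y. dist y a = r \<Longrightarrow> U y \<le> U a + K * ((r + \<tau>) powr (4/3) - \<tau> powr (4/3))"
    and y: "y \<in> cball a r"
  shows "U y \<le> U a + K * ((dist y a + \<tau>) powr (4/3) - \<tau> powr (4/3))"
proof -
  define \<zeta> where "\<zeta> = (\<lambda>y. U y - K * (dist y a + \<tau>) powr (4/3))"
  have "continuous_on (cball a r) \<zeta>"
    unfolding \<zeta>_def using \<open>\<tau> \<ge> 0\<close>
    by (intro continuous_intros continuous_on_powr' continuous_on_subset[OF cont])
      (auto simp: add_nonneg_nonneg)
  then obtain x0 where x0: "x0 \<in> cball a r" "\<And>y. y \<in> cball a r \<Longrightarrow> \<zeta> y \<le> \<zeta> x0"
    using continuous_attains_sup[of "cball a r" \<zeta>] \<open>r > 0\<close> by fastforce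
  have "\<zeta> x0 \<le> \<zeta> a"
  proof (cases "x0 = a \<or> dist x0 a = r")
    case True
    then show ?thesis
      using bd[of x0] by (auto simp: \<zeta>_def algebra_simps)
  next
    case False
    then have x0': "x0 \<in> ball a r" "x0 \<noteq> a"
      using x0(1) by (auto simp: dist_commute)
    have "h (U x0) \<le> 64 / 81 * K ^ 3"
    proof (rule radial_subD[OF sub, where a = a and \<sigma> = 1 and \<tau> = \<tau> and N = "ball a r"])
      show "0 < 1 * dist x0 a + \<tau>"
        using x0' \<open>\<tau> \<ge> 0\<close> by (simp add: add_pos_nonneg)
    qed (use x0' x0(2) ball in \<open>auto simp: \<zeta>_def\<close>)
    with h[OF x0'(1)] show ?thesis by simp
  qed
  with x0(2)[OF y] show ?thesis by (simp add: \<zeta>_def algebra_simps)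
qed

text \<open>The argument of the convex case with the profile reflected in the radius: its increment
  from centre to sphere is the same, but its infinity-Laplacian has the opposite sign.\<close>

lemma radial_comparison_concave:
  fixes V :: "real ^ 'n \<Rightarrow> real"
  assumes sub: "radial_sub h \<Omega> V" and cont: "continuous_on UNIV V"
    and ball: "cball a r \<subseteq> \<Omega>" and "r > 0"
    and h: "\<And>x. x \<in> ball a r \<Longrightarrow> - (64 / 81 * K ^ 3) < h (V x)"
    and "\<tau> \<ge> 0"
    and bd: "\<And>y. dist y a = r \<Longrightarrow> V y \<le> V a + K * ((r + \<tau>) powr (4/3) - \<tau> powr (4/3))"
    and y: "y \<in> cball a r"
  shows "V y \<le> V a + K * ((r + \<tau>) powr (4/3) - (r + \<tau> - dist y a) powr (4/3))"
proof -
  define \<zeta> where "\<zeta> = (\<lambda>y. V y + K * (r + \<tau> - dist y a) powr (4/3))"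
  have "continuous_on (cball a r) \<zeta>"
    unfolding \<zeta>_def using \<open>\<tau> \<ge> 0\<close>
    by (intro continuous_intros continuous_on_powr' continuous_on_subset[OF cont])
      (auto simp: dist_commute)
  then obtain x0 where x0: "x0 \<in> cball a r" "\<And>y. y \<in> cball a r \<Longrightarrow> \<zeta> y \<le> \<zeta> x0"
    using continuous_attains_sup[of "cball a r" \<zeta>] \<open>r > 0\<close> by fastforce
  have "\<zeta> x0 \<le> \<zeta> a"
  proof (cases "x0 = a \<or> dist x0 a = r")
    case True
    then show ?thesis
      using bd[of x0] by (auto simp: \<zeta>_def algebra_simps)
  next
    case False
    then have x0': "x0 \<in> ball a r" "x0 \<noteq> a"
      using x0(1) by (auto simp: dist_commute)
    have "h (V x0) \<le> 64 / 81 * (- K) ^ 3"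
    proof (rule radial_subD[OF sub, where a = a and \<sigma> = "-1" and \<tau> = "r + \<tau>" and N = "ball a r"])
      show "0 < - 1 * dist x0 a + (r + \<tau>)"
        using x0' \<open>\<tau> \<ge> 0\<close> by (simp add: dist_commute)
      fix y assume "y \<in> ball a r"
      then have "y \<in> cball a r" by simp
      from x0(2)[OF this]
      show "V y - - K * (- 1 * dist y a + (r + \<tau>)) powr (4/3)
          \<le> V x0 - - K * (- 1 * dist x0 a + (r + \<tau>)) powr (4/3)"
        by (simp add: \<zeta>_def algebra_simps)
    qed (use x0' ball in auto)
    with h[OF x0'(1)] show ?thesis by simp
  qed
  with x0(2)[OF y] show ?thesis by (simp add: \<zeta>_def algebra_simps)
qed

section \<open>Minimal growth of a strict subsolution on a ball\<close>

lemma powr_four_thirds: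
  fixes x :: real
  assumes "x > 0"
  shows "x powr (4/3) = x * x powr (1/3)"
proof -
  have "x powr (4/3) = x powr (1 + 1/3)" by simp
  also have "\<dots> = x * x powr (1/3)"
    using assms unfolding powr_add by simp
  finally show ?thesis .
qed

lemma has_derivative_zero_if_powr_bound:
  fixes U :: "'a::real_normed_vector \<Rightarrow> real"
  assumes "open B" "p \<in> B"
    and bd: "\<And>y. y \<in> B \<Longrightarrow> \<bar>U y - U p\<bar> \<le> K * dist y p powr (4/3)"
  shows "(U has_derivative (\<lambda>_. 0)) (at p)"
proof -
  have "((\<lambda>y. K * dist y p powr (1/3)) \<longlongrightarrow> K * dist p p powr (1/3)) (at p)"
    by (intro tendsto_intros tendsto_powr') (auto simp: eventually_at_filter)
  then have lim: "((\<lambda>y. K * dist y p powr (1/3)) \<longlongrightarrow> 0) (at p)" by simp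
  have "\<forall>\<^sub>F y in at p. norm (norm (U y - U p) / norm (y - p)) \<le> K * dist y p powr (1/3)"
    using eventually_at_in_open[OF assms(1,2)]
  proof eventually_elim
    case (elim y)
    then have d: "dist y p > 0" by simp
    show ?case
      using bd[of y] elim d by (simp add: powr_four_thirds dist_norm field_simps)
  qed
  then have "((\<lambda>y. norm (U y - U p) / norm (y - p)) \<longlongrightarrow> 0) (at p)"
    using lim by (rule Lim_null_comparison)
  then show ?thesis
    by (simp add: has_derivative_iff_norm)
qed

text \<open>If the bound failed, comparison with centre near \<open>a\<close> would make \<open>U\<close> Hoelder continuous with
  exponent \<open>4/3 > 1\<close>, hence constant, near \<open>a\<close>.\<close>

lemma radial_sub_growth:
  fixes U :: "real ^ 'n \<Rightarrow> real"
  assumes sub: "radial_sub h \<Omega> U" and cont: "continuous_on UNIV U"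
    and ball: "cball a r \<subseteq> \<Omega>" and "r > 0" and "K > 0"
    and h: "\<And>x. x \<in> ball a r \<Longrightarrow> 64 / 81 * K ^ 3 < h (U x)"
    and P: "\<And>y. y \<in> cball a r \<Longrightarrow> U y \<le> U a + P"
  shows "K * r powr (4/3) \<le> P"
proof (rule ccontr)
  assume "\<not> K * r powr (4/3) \<le> P"
  then have less: "0 < K * r powr (4/3) - P" by simp
  \<comment> \<open>Positivity of \<xi> at p says that the bound by P implies the boundary condition
    of the comparison on the sphere about p of radius r - dist p a. It holds at p = a, hence at
    nearby centres by continuity.\<close>
  define \<xi> where "\<xi> = (\<lambda>p. K * (r - dist p a) powr (4/3) + U p - U a - P)"
  have "continuous (at a) U" using cont by (simp add: continuous_on_eq_continuous_at)
  then have "(\<xi> \<longlongrightarrow> K * (r - dist a a) powr (4/3) + U a - U a - P) (nhds a)"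
    unfolding \<xi>_def using \<open>r > 0\<close>
    by (intro tendsto_intros filterlim_ident) (auto simp: continuous_within tendsto_at_iff_tendsto_nhds)
  then have "\<forall>\<^sub>F p in nhds a. \<xi> p > 0"
    using less by (intro order_tendstoD(1)) auto
  then obtain d where "d > 0" and d: "\<And>p. dist p a < d \<Longrightarrow> \<xi> p > 0"
    by (auto simp: eventually_nhds_metric)
  \<comment> \<open>Two points within r/3 of \<open>a\<close> are closer to each other than either
    is to the sphere of radius r, so each lies in the comparison ball of the other.\<close>
  define \<rho> where "\<rho> = min d (r / 3)"
  have "\<rho> > 0" "\<rho> \<le> d" "3 * \<rho> \<le> r" using \<open>d > 0\<close> \<open>r > 0\<close> by (auto simp: \<rho>_def)
  have bd: "U y \<le> U p + K * dist y p powr (4/3)" if p: "p \<in> ball a \<rho>" and y: "y \<in> ball a \<rho>" for p y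
  proof -
    define R where "R = r - dist p a"
    have pa: "dist p a < \<rho>" "dist y a < \<rho>" using p y by (auto simp: dist_commute)
    have "R > 0" using pa \<open>3 * \<rho> \<le> r\<close> \<open>\<rho> > 0\<close> by (simp add: R_def)
    have in_ball: "cball p R \<subseteq> cball a r" "ball p R \<subseteq> ball a r"
      by (auto simp: R_def subset_iff) (metric+)
    \<comment> \<open>With \<tau> = 0 the profile is a pure 4/3-power of the distance; exchanging p
      and y later gives the two-sided bound.\<close>
    have "U y \<le> U p + K * ((dist y p + 0) powr (4/3) - 0 powr (4/3))"
    proof (rule radial_comparison_convex[OF sub cont, where r = R])
      show "cball p R \<subseteq> \<Omega>" using in_ball ball by blast
      fix z assume "dist z p = R"
      then have "z \<in> cball a r" using in_ball by (auto simp: dist_commute)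
      from P[OF this] show "U z \<le> U p + K * ((R + 0) powr (4/3) - 0 powr (4/3))"
        using d[of p] pa \<open>\<rho> \<le> d\<close> by (simp add: \<xi>_def R_def)
    next
      have "dist p y < 2 * \<rho>" using pa by metric
      then show "y \<in> cball p R" using pa \<open>3 * \<rho> \<le> r\<close> by (simp add: R_def)
    qed (use h in_ball \<open>R > 0\<close> in auto)
    then show ?thesis by simp
  qed
  have "(U has_derivative (\<lambda>_. 0)) (at p within ball a \<rho>)" if p: "p \<in> ball a \<rho>" for p
  proof -
    have "\<bar>U y - U p\<bar> \<le> K * dist y p powr (4/3)" if "y \<in> ball a \<rho>" for y
      using bd[OF p that] bd[OF that p] by (simp add: dist_commute abs_le_iff)
    then show ?thesis
      using has_derivative_zero_if_powr_bound[of "ball a \<rho>" p U K] p has_derivative_at_withinI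
      by blast
  qed
  then obtain C where C: "\<And>p. p \<in> ball a \<rho> \<Longrightarrow> U p = C"
    using has_derivative_zero_constant[of "ball a \<rho>" U] by auto
  have "bounded {a}" by simp
  then have "{a} \<noteq> UNIV" using not_bounded_UNIV by metis
  then obtain b where "b \<noteq> a" by blast
  \<comment> \<open>Near \<open>a\<close> the function is constant and is touched by a constant
    (\<kappa> = 0); any other point b may serve as centre.\<close>
  have "h (U a) \<le> 64 / 81 * 0 ^ 3"
    by (rule radial_subD[OF sub, where a = b and \<sigma> = 1 and \<tau> = 0 and N = "ball a \<rho>"])
      (use \<open>b \<noteq> a\<close> \<open>\<rho> > 0\<close> \<open>3 * \<rho> \<le> r\<close> C ball in auto)
  then have "h (U a) \<le> 0" by simp
  moreover have "64 / 81 * K ^ 3 < h (U a)" using \<open>r > 0\<close> by (intro h) simp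
  moreover have "K ^ 3 > 0" using \<open>K > 0\<close> by simp
  ultimately show False by linarith
qed

section \<open>Increments of shifted 4/3-powers\<close>

lemma powr_four_thirds_superadditive:
  fixes s t :: real
  assumes "0 \<le> s" "0 \<le> t"
  shows "s powr (4/3) + t powr (4/3) \<le> (s + t) powr (4/3)"
proof (cases "s = 0 \<or> t = 0")
  case False
  then have pos: "s > 0" "t > 0" using assms by auto
  have "s * s powr (1/3) \<le> s * (s + t) powr (1/3)" "t * t powr (1/3) \<le> t * (s + t) powr (1/3)"
    using pos by (auto intro!: mult_left_mono powr_mono2)
  then show ?thesis unfolding powr_four_thirds[OF pos(1)] powr_four_thirds[OF pos(2)]
      powr_four_thirds[OF add_pos_pos[OF pos]]
    by (simp add: distrib_right)
qed auto

text \<open>Used to fit a profile to an observed increment P. Shift 0 gives the increment K r^(4/3),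
  large shifts give arbitrarily large ones, and the intermediate value theorem does the
  rest.\<close>

lemma powr_increment_surj:
  fixes r P K :: real
  assumes "r > 0" "K > 0" "K * r powr (4/3) \<le> P"
  obtains \<tau> where "\<tau> \<ge> 0" "P = K * ((r + \<tau>) powr (4/3) - \<tau> powr (4/3))"
proof -
  define F where "F = (\<lambda>\<tau>. K * ((r + \<tau>) powr (4/3) - \<tau> powr (4/3)))"
  have "P \<ge> 0" using assms by (meson mult_nonneg_nonneg order.trans less_imp_le powr_ge_zero)
  \<comment> \<open>The increment at shift T is at least K r T^(1/3), and this T makes the lower
    bound equal to P.\<close>
  define T where "T = (P / (K * r)) ^ 3"
  have "T \<ge> 0" using \<open>P \<ge> 0\<close> assms by (simp add: T_def)
  have "P \<le> F T"
  proof (cases "T = 0")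
    case True
    then have "P = 0" using assms by (auto simp: T_def)
    then show ?thesis using assms \<open>T = 0\<close> by (simp add: F_def)
  next
    case False
    then have "T > 0" using \<open>T \<ge> 0\<close> by simp
    then have "P > 0" using \<open>P \<ge> 0\<close> by (auto simp: T_def order_less_le)
    have T3: "T powr (1/3) = P / (K * r)"
      using \<open>P > 0\<close> assms unfolding T_def
      by (simp add: powr_powr flip: powr_numeral)
    have "T powr (1/3) \<le> (r + T) powr (1/3)"
      using \<open>T > 0\<close> assms by (auto intro!: powr_mono2)
    then have "(r + T) * T powr (1/3) \<le> (r + T) * (r + T) powr (1/3)"
      using \<open>T > 0\<close> assms by (intro mult_left_mono) auto
    then have "r * T powr (1/3) \<le> (r + T) powr (4/3) - T powr (4/3)"
      using \<open>T > 0\<close> assms by (simp add: powr_four_thirds algebra_simps)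
    then have "K * (r * T powr (1/3)) \<le> F T"
      unfolding F_def using assms by (intro mult_left_mono) auto
    then show ?thesis using assms by (simp add: T3)
  qed
  moreover have "F 0 \<le> P" using assms by (simp add: F_def)
  moreover have "continuous_on {0..T} F"
    unfolding F_def using assms by (intro continuous_intros continuous_on_powr') auto
  ultimately obtain \<tau> where "\<tau> \<ge> 0" "F \<tau> = P"
    using IVT'[of F 0 P T] \<open>T \<ge> 0\<close> by auto
  then show ?thesis using that by (auto simp: F_def)
qed

text \<open>Let F be the difference of the two profiles. By the mean value theorem F' is nonnegative
  somewhere in (0, \<epsilon>) and nonpositive somewhere in (\<epsilon>, 2\<epsilon>). Comparing
  cubes, the sign of F' is that of A^3 (\<rho> + \<tau>) - B^3 (\<rho> + \<tau>'), which is strictly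
  increasing in \<rho>.\<close>

lemma powr_profiles_incompatible:
  fixes A B \<epsilon> \<tau> \<tau>' :: real
  assumes "0 < B" "B < A" "0 < \<epsilon>" "0 \<le> \<tau>" "0 \<le> \<tau>'"
    and outer: "A * ((2 * \<epsilon> + \<tau>) powr (4/3) - (\<epsilon> + \<tau>) powr (4/3))
      \<le> B * ((2 * \<epsilon> + \<tau>') powr (4/3) - (\<epsilon> + \<tau>') powr (4/3))"
    and inner: "B * ((\<epsilon> + \<tau>') powr (4/3) - \<tau>' powr (4/3))
      \<le> A * ((\<epsilon> + \<tau>) powr (4/3) - \<tau> powr (4/3))"
  shows False
proof -
  define F where "F = (\<lambda>\<rho>. A * (\<rho> + \<tau>) powr (4/3) - B * (\<rho> + \<tau>') powr (4/3))"
  define F' where "F' = (\<lambda>\<rho>. A * (4/3 * (\<rho> + \<tau>) powr (1/3)) - B * (4/3 * (\<rho> + \<tau>') powr (1/3)))"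
  have D: "(F has_real_derivative F' \<rho>) (at \<rho>)" if "\<rho> > 0" for \<rho>
    unfolding F_def F'_def using that assms
    by (auto intro!: derivative_eq_intros simp: add_pos_nonneg algebra_simps)
  have C: "continuous_on {x..y} F" if "x \<ge> 0" for x y
    unfolding F_def using that assms by (intro continuous_intros continuous_on_powr') auto
  have mvt: "\<exists>z. x < z \<and> z < y \<and> F y - F x = (y - x) * F' z" if "0 \<le> x" "x < y" for x y
  proof -
    have DF: "(F has_real_derivative F' t) (at t)" if "x < t" for t
      using D that \<open>0 \<le> x\<close> by simp
    then obtain l z where "x < z" "z < y" "(F has_real_derivative l) (at z)" "F y - F x = (y - x) * l"
      using MVT[OF \<open>x < y\<close> C[OF \<open>0 \<le> x\<close>]] by (auto simp: real_differentiable_def)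
    moreover from this have "l = F' z" using DF DERIV_unique by blast
    ultimately show ?thesis by blast
  qed
  have cube: "(a * t powr (1/3)) ^ 3 = a ^ 3 * t" if "t > 0" for a t :: real
    using that by (simp add: power_mult_distrib powr_powr flip: powr_numeral)
  obtain \<rho>1 where \<rho>1: "0 < \<rho>1" "\<rho>1 < \<epsilon>" "F \<epsilon> - F 0 = (\<epsilon> - 0) * F' \<rho>1"
    using mvt[of 0 \<epsilon>] \<open>0 < \<epsilon>\<close> by auto
  have "F \<epsilon> - F 0 \<ge> 0" using inner by (simp add: F_def algebra_simps)
  then have "F' \<rho>1 \<ge> 0" using \<rho>1 \<open>0 < \<epsilon>\<close> by (simp add: zero_le_mult_iff)
  then have "(B * (\<rho>1 + \<tau>') powr (1/3)) ^ 3 \<le> (A * (\<rho>1 + \<tau>) powr (1/3)) ^ 3"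
    using assms by (intro power_mono) (auto simp: F'_def)
  then have 1: "B ^ 3 * (\<rho>1 + \<tau>') \<le> A ^ 3 * (\<rho>1 + \<tau>)"
    using \<rho>1 assms by (simp add: cube)
  obtain \<rho>2 where \<rho>2: "\<epsilon> < \<rho>2" "\<rho>2 < 2 * \<epsilon>" "F (2 * \<epsilon>) - F \<epsilon> = (2 * \<epsilon> - \<epsilon>) * F' \<rho>2"
    using mvt[of \<epsilon> "2 * \<epsilon>"] \<open>0 < \<epsilon>\<close> by auto
  have "F (2 * \<epsilon>) - F \<epsilon> \<le> 0" using outer by (simp add: F_def algebra_simps)
  then have "F' \<rho>2 \<le> 0" using \<rho>2 \<open>0 < \<epsilon>\<close> by (simp add: mult_le_0_iff)
  then have "(A * (\<rho>2 + \<tau>) powr (1/3)) ^ 3 \<le> (B * (\<rho>2 + \<tau>') powr (1/3)) ^ 3"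
    using assms by (intro power_mono) (auto simp: F'_def)
  then have 2: "A ^ 3 * (\<rho>2 + \<tau>) \<le> B ^ 3 * (\<rho>2 + \<tau>')"
    using \<rho>2 \<open>0 < \<epsilon>\<close> assms by (simp add: cube)
  have "A ^ 3 * (\<rho>2 - \<rho>1) \<le> B ^ 3 * (\<rho>2 - \<rho>1)"
    using 1 2 by (simp add: algebra_simps)
  moreover have "B ^ 3 < A ^ 3" using assms by (intro power_strict_mono) auto
  ultimately show False using \<rho>1 \<rho>2 by simp
qed

subsection \<open>Comparison principle\<close>

text \<open>The largest increments P of U and Q of V from x are both at most \<alpha> + \<beta>.
  Radial comparison bounds \<alpha> above by the inner increment of a profile with factor A and
  \<beta> by the outer increment of one with factor B. Subtracting from P and Q yields the reverse
  bounds, which contradict each other since B < A.\<close>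

lemma radial_sub_no_doubled_max:
  fixes U V :: "real ^ 'n \<Rightarrow> real"
  assumes U: "radial_sub hU \<Omega> U" "continuous_on UNIV U"
    and V: "radial_sub hV \<Omega> V" "continuous_on UNIV V"
    and "0 < B" "B < A" "0 < \<epsilon>" and ball: "cball x (2 * \<epsilon>) \<subseteq> \<Omega>"
    and hU: "\<And>p. p \<in> ball x (2 * \<epsilon>) \<Longrightarrow> 64 / 81 * A ^ 3 < hU (U p)"
    and hV: "\<And>p. p \<in> ball x (2 * \<epsilon>) \<Longrightarrow> - (64 / 81 * B ^ 3) < hV (V p)"
    and yz: "dist y x \<le> \<epsilon>" "dist z x \<le> \<epsilon>"
    and maxU: "\<And>p. p \<in> cball x (2 * \<epsilon>) \<Longrightarrow> U p + V x \<le> U y + V z"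
    and maxV: "\<And>q. q \<in> cball x (2 * \<epsilon>) \<Longrightarrow> U x + V q \<le> U y + V z"
  shows False
proof -
  define \<alpha> \<beta> where "\<alpha> = U y - U x" and "\<beta> = V z - V x"
  have r: "2 * \<epsilon> > 0" using \<open>0 < \<epsilon>\<close> by simp
  have cb: "compact (cball x (2 * \<epsilon>))" "cball x (2 * \<epsilon>) \<noteq> {}" using \<open>0 < \<epsilon>\<close> by auto
  have "A > 0" using \<open>0 < B\<close> \<open>B < A\<close> by simp
  obtain p where p: "p \<in> cball x (2 * \<epsilon>)" "\<And>w. w \<in> cball x (2 * \<epsilon>) \<Longrightarrow> U w \<le> U p"
    using continuous_attains_sup[OF cb continuous_on_subset[OF U(2)]] by auto
  obtain q where q: "q \<in> cball x (2 * \<epsilon>)" "\<And>w. w \<in> cball x (2 * \<epsilon>) \<Longrightarrow> V w \<le> V q"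
    using continuous_attains_sup[OF cb continuous_on_subset[OF V(2)]] by auto
  define P Q where "P = U p - U x" and "Q = V q - V x"
  have P: "U w \<le> U x + P" if "w \<in> cball x (2 * \<epsilon>)" for w
    using p(2)[OF that] by (simp add: P_def)
  have Q: "V w \<le> V x + Q" if "w \<in> cball x (2 * \<epsilon>)" for w
    using q(2)[OF that] by (simp add: Q_def)
  have PQ: "P \<le> \<alpha> + \<beta>" "Q \<le> \<alpha> + \<beta>"
    using maxU[OF p(1)] maxV[OF q(1)] by (auto simp: P_def Q_def \<alpha>_def \<beta>_def)
  have "A * (2 * \<epsilon>) powr (4/3) \<le> P"
    by (rule radial_sub_growth[OF U ball r \<open>A > 0\<close> hU P])
  then obtain \<tau> where \<tau>: "\<tau> \<ge> 0" "P = A * ((2 * \<epsilon> + \<tau>) powr (4/3) - \<tau> powr (4/3))"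
    using powr_increment_surj[OF r \<open>A > 0\<close>] by metis
  have "U y \<le> U x + A * ((dist y x + \<tau>) powr (4/3) - \<tau> powr (4/3))"
  proof (rule radial_comparison_convex[OF U ball r hU \<tau>(1)])
    show "U w \<le> U x + A * ((2 * \<epsilon> + \<tau>) powr (4/3) - \<tau> powr (4/3))" if "dist w x = 2 * \<epsilon>" for w
      using P[of w] that by (simp add: \<tau>(2)[symmetric] dist_commute)
    show "y \<in> cball x (2 * \<epsilon>)" using yz \<open>0 < \<epsilon>\<close> by (simp add: dist_commute)
  qed
  also have "\<dots> \<le> U x + A * ((\<epsilon> + \<tau>) powr (4/3) - \<tau> powr (4/3))"
    using \<open>A > 0\<close> yz \<tau> by (intro add_left_mono mult_left_mono diff_right_mono powr_mono2) auto
  finally have \<alpha>: "\<alpha> \<le> A * ((\<epsilon> + \<tau>) powr (4/3) - \<tau> powr (4/3))"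
    by (simp add: \<alpha>_def)
  \<comment> \<open>The shift is left open because an exact fit to Q exists only if Q is large
    enough.\<close>
  have \<beta>: "\<beta> \<le> B * ((2 * \<epsilon> + \<tau>') powr (4/3) - (\<epsilon> + \<tau>') powr (4/3))"
    if \<tau>0: "\<tau>' \<ge> 0" and Qle: "Q \<le> B * ((2 * \<epsilon> + \<tau>') powr (4/3) - \<tau>' powr (4/3))" for \<tau>'
  proof -
    have "V z \<le> V x + B * ((2 * \<epsilon> + \<tau>') powr (4/3) - (2 * \<epsilon> + \<tau>' - dist z x) powr (4/3))"
    proof (rule radial_comparison_concave[OF V ball r hV \<tau>0])
      show "V w \<le> V x + B * ((2 * \<epsilon> + \<tau>') powr (4/3) - \<tau>' powr (4/3))" if "dist w x = 2 * \<epsilon>" for w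
        using Q[of w] that Qle by (simp add: dist_commute)
      show "z \<in> cball x (2 * \<epsilon>)" using yz \<open>0 < \<epsilon>\<close> by (simp add: dist_commute)
    qed
    also have "\<dots> \<le> V x + B * ((2 * \<epsilon> + \<tau>') powr (4/3) - (\<epsilon> + \<tau>') powr (4/3))"
      using \<open>B > 0\<close> \<open>\<epsilon> > 0\<close> yz \<tau>0
      by (intro add_left_mono mult_left_mono diff_left_mono powr_mono2) auto
    finally show ?thesis by (simp add: \<beta>_def)
  qed
  have outer: "A * ((2 * \<epsilon> + \<tau>) powr (4/3) - (\<epsilon> + \<tau>) powr (4/3)) \<le> \<beta>"
    using \<alpha> PQ(1) unfolding \<tau>(2) by (simp add: algebra_simps)
  show False
  proof (cases "B * (2 * \<epsilon>) powr (4/3) \<le> Q")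
    case True
    then obtain \<tau>' where \<tau>': "\<tau>' \<ge> 0" "Q = B * ((2 * \<epsilon> + \<tau>') powr (4/3) - \<tau>' powr (4/3))"
      using powr_increment_surj[OF r \<open>B > 0\<close>] by metis
    then have \<beta>': "\<beta> \<le> B * ((2 * \<epsilon> + \<tau>') powr (4/3) - (\<epsilon> + \<tau>') powr (4/3))"
      by (intro \<beta>) auto
    have "B * ((\<epsilon> + \<tau>') powr (4/3) - \<tau>' powr (4/3)) \<le> \<alpha>"
      using \<beta>' PQ(2) unfolding \<tau>'(2) by (simp add: algebra_simps)
    then show ?thesis
      by (intro powr_profiles_incompatible[OF \<open>0 < B\<close> \<open>B < A\<close> \<open>0 < \<epsilon>\<close> \<tau>(1) \<tau>'(1)]
        order_trans[OF outer \<beta>'] order_trans[OF _ \<alpha>])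
  next
    \<comment> \<open>Here Q is below every fitted increment, so \<tau>' = 0 is used. The inner
      inequality then follows from superadditivity of the 4/3-power instead of from Q.\<close>
    case False
    then have \<beta>': "\<beta> \<le> B * ((2 * \<epsilon> + 0) powr (4/3) - (\<epsilon> + 0) powr (4/3))"
      by (intro \<beta>) auto
    have "B * \<epsilon> powr (4/3) \<le> A * \<epsilon> powr (4/3)"
      using \<open>B < A\<close> by (intro mult_right_mono) auto
    also have "\<dots> \<le> A * ((\<epsilon> + \<tau>) powr (4/3) - \<tau> powr (4/3))"
      using powr_four_thirds_superadditive[of \<epsilon> \<tau>] \<open>0 < \<epsilon>\<close> \<tau> \<open>A > 0\<close> by (intro mult_left_mono) auto
    finally show ?thesis
      by (intro powr_profiles_incompatible[OF \<open>0 < B\<close> \<open>B < A\<close> \<open>0 < \<epsilon>\<close> \<tau>(1) order.refl]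
        order_trans[OF outer \<beta>']) simp
  qed
qed

section \<open>Stretching a subsolution and doubling the variables\<close>

lemma radial_sub_scale:
  assumes sub: "radial_sub h \<Omega> U" and "\<mu> > 0"
  shows "radial_sub (\<lambda>t. \<mu> ^ 3 * h ((t - b) / \<mu>)) \<Omega> (\<lambda>x. \<mu> * U x + b)"
  unfolding radial_sub_def
proof (intro allI impI)
  fix x0 a \<kappa> \<sigma> \<tau>
  assume *: "\<bar>\<sigma>\<bar> = 1" "a \<noteq> x0" "0 < \<sigma> * dist x0 a + \<tau>"
    and lm: "local_max_in \<Omega> (\<lambda>x. \<mu> * U x + b - \<kappa> * (\<sigma> * dist x a + \<tau>) powr (4/3)) x0"
  have "local_max_in \<Omega> (\<lambda>x. U x - \<kappa> / \<mu> * (\<sigma> * dist x a + \<tau>) powr (4/3)) x0"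
  proof -
    have "U x - \<kappa> / \<mu> * t = (\<mu> * U x + b - \<kappa> * t) / \<mu> - b / \<mu>" for x t
      using \<open>\<mu> > 0\<close> by (simp add: field_simps)
    then show ?thesis
      using lm \<open>\<mu> > 0\<close> unfolding local_max_in_def
      by (auto intro: divide_right_mono elim!: eventually_mono)
  qed
  then have "h (U x0) \<le> 64 / 81 * (\<kappa> / \<mu>) ^ 3"
    using sub * unfolding radial_sub_def by blast
  then show "\<mu> ^ 3 * h ((\<mu> * U x0 + b - b) / \<mu>) \<le> 64 / 81 * \<kappa> ^ 3"
    using \<open>\<mu> > 0\<close> by (simp add: field_simps power_divide)
qed

text \<open>The sign of h c gives U \<le> c, so stretching U away from c lowers it and keeps its
  boundary values. The factor \<mu>^3 gained on the right-hand side is a strict gain because h(U) >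
  0 near the maximizing pair. Monotonicity is asked only on a set S of values, as h will be
  prescribed through its values at \<Phi>(t).\<close>

lemma radial_sub_add_nonpos_aux:
  fixes \<Omega> :: "(real ^ 'n) set"
  assumes \<Omega>: "open \<Omega>" "bounded \<Omega>"
    and U: "continuous_on UNIV U" "radial_sub h \<Omega> U" "\<And>x. x \<notin> \<Omega> \<Longrightarrow> U x = c"
    and V: "continuous_on UNIV V" "radial_sub (\<lambda>t. - h (- t)) \<Omega> V" "\<And>x. x \<notin> \<Omega> \<Longrightarrow> V x = - c"
    and S: "mono_on S h" "c \<in> S" "\<And>x. U x \<in> S" "\<And>x. - V x \<in> S"
    and "h c \<ge> 0"
  shows "U x + V x \<le> 0"
proof (rule ccontr)
  assume "\<not> U x + V x \<le> 0"
  then have "U x + V x > 0" by simp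
  then obtain x1 where x1: "U x1 + V x1 > 0" by blast
  have h_mono: "h s \<le> h t" if "s \<in> S" "t \<in> S" "s \<le> t" for s t
    using S(1) that by (auto simp: mono_on_def)
  have Uc: "U x \<le> c" for x
  proof (rule radial_sub_le[OF \<Omega> U(1) _ U(2)])
    show "h (U y) \<ge> 0" if "c \<le> U y" for y
      using h_mono[OF S(2) S(3) that] \<open>h c \<ge> 0\<close> by simp
  qed (use U in auto)
  \<comment> \<open>Stretching lowers U x1 by \<eta> (c - U x1), at most half of U x1 + V x1, so the
    sum stays positive; the added 1 keeps the denominator positive.\<close>
  define \<eta> where "\<eta> = (U x1 + V x1) / (2 * (c - U x1 + 1))"
  have "\<eta> > 0" using x1 Uc[of x1] by (auto simp: \<eta>_def intro!: divide_pos_pos)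
  define \<mu> where "\<mu> = 1 + \<eta>"
  define b where "b = - (\<eta> * c)"
  define T where "T = (\<lambda>x. \<mu> * U x + b)"
  have "\<mu> > 0" using \<open>\<eta> > 0\<close> by (simp add: \<mu>_def)
  have T_eq: "T x = U x - \<eta> * (c - U x)" for x
    by (simp add: T_def \<mu>_def b_def algebra_simps)
  have TU: "T x \<le> U x" for x
    using \<open>\<eta> > 0\<close> Uc[of x] by (simp add: T_eq)
  have contT: "continuous_on UNIV T" unfolding T_def by (intro continuous_intros U)
  have subT: "radial_sub (\<lambda>t. \<mu> ^ 3 * h ((t - b) / \<mu>)) \<Omega> T"
    unfolding T_def by (rule radial_sub_scale[OF U(2) \<open>\<mu> > 0\<close>])
  have out: "T x + V x = 0" if "x \<notin> \<Omega>" for x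
    using that by (simp add: T_eq U V)
  define m where "m = T x1 + V x1"
  have "\<eta> * (c - U x1) \<le> \<eta> * (c - U x1 + 1)" using \<open>\<eta> > 0\<close> by simp
  also have "\<dots> = (U x1 + V x1) / 2"
    using Uc[of x1] by (simp add: \<eta>_def field_simps)
  finally have "m > 0" using x1 by (simp add: m_def T_eq)
  then have "x1 \<in> \<Omega>" using out by (force simp: m_def)
  obtain R where "\<And>x. x \<in> \<Omega> \<Longrightarrow> norm x \<le> R"
    using \<open>bounded \<Omega>\<close> by (auto simp: bounded_iff)
  then have R: "\<Omega> \<subseteq> cball 0 R" by auto
  have "uniformly_continuous_on (cball 0 (R + 2)) T"
    by (rule compact_uniformly_continuous[OF continuous_on_subset[OF contT subset_UNIV] compact_cball])
  then obtain d1 where d1: "d1 > 0" "\<And>x y. x \<in> cball 0 (R + 2) \<Longrightarrow> y \<in> cball 0 (R + 2) \<Longrightarrow>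
      dist x y < d1 \<Longrightarrow> dist (T x) (T y) < m / 2"
    by (rule uniformly_continuous_onE[OF _ half_gt_zero[OF \<open>m > 0\<close>]]) (metis dist_commute)
  have "uniformly_continuous_on (cball 0 (R + 2)) V"
    by (rule compact_uniformly_continuous[OF continuous_on_subset[OF V(1) subset_UNIV] compact_cball])
  then obtain d2 where d2: "d2 > 0" "\<And>x y. x \<in> cball 0 (R + 2) \<Longrightarrow> y \<in> cball 0 (R + 2) \<Longrightarrow>
      dist x y < d2 \<Longrightarrow> dist (V x) (V y) < m / 2"
    by (rule uniformly_continuous_onE[OF _ half_gt_zero[OF \<open>m > 0\<close>]]) (metis dist_commute)
  \<comment> \<open>Points of the ball of radius 2\<epsilon> about the midpoint are within
    3\<epsilon> of y and of z, and \<epsilon> \<le> 1 keeps them in the ball of radius R + 2. The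
    two oscillations below m/2 then cannot use up the maximum.\<close>
  define \<epsilon> where "\<epsilon> = min 1 (min d1 d2 / 4)"
  have \<epsilon>: "\<epsilon> > 0" "\<epsilon> \<le> 1" "3 * \<epsilon> < d1" "3 * \<epsilon> < d2"
    using d1(1) d2(1) by (auto simp: \<epsilon>_def min_def)
  define C where "C = (cball 0 R \<times> cball (0 :: real ^ 'n) R) \<inter> {(y, z). dist y z \<le> 2 * \<epsilon>}"
  have cl: "closed {(y, z :: real ^ 'n). dist y z \<le> 2 * \<epsilon>}"
    unfolding case_prod_beta by (intro closed_Collect_le continuous_intros)
  have "compact C"
    unfolding C_def by (intro compact_Int_closed compact_Times compact_cball cl)
  moreover have "(x1, x1) \<in> C"
    using \<open>x1 \<in> \<Omega>\<close> R \<epsilon> by (auto simp: C_def)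
  moreover have "continuous_on C (\<lambda>yz. T (fst yz) + V (snd yz))"
    by (intro continuous_intros continuous_on_compose2[OF contT] continuous_on_compose2[OF V(1)]) auto
  ultimately obtain y z where yz: "(y, z) \<in> C" "\<And>p q. (p, q) \<in> C \<Longrightarrow> T p + V q \<le> T y + V z"
    using continuous_attains_sup[of C "\<lambda>yz. T (fst yz) + V (snd yz)"] by fastforce
  have m: "m \<le> T y + V z"
    using yz(2)[OF \<open>(x1, x1) \<in> C\<close>] by (simp add: m_def)
  define x where "x = midpoint y z"
  have yz_x: "dist y x \<le> \<epsilon>" "dist z x \<le> \<epsilon>"
    using yz(1) by (auto simp: C_def x_def dist_midpoint)
  have yzR: "y \<in> cball 0 R" "z \<in> cball 0 R" using yz(1) by (auto simp: C_def)
  then have "x \<in> cball 0 R"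
    using convex_contains_segment[of "cball 0 R"] midpoints_in_convex_hull
    unfolding x_def by (metis convex_cball convex_contains_segment midpoint_in_closed_segment subsetD)
  have pos: "T p + V q > 0" if "p \<in> cball x (2 * \<epsilon>)" "q \<in> cball x (2 * \<epsilon>)" for p q
  proof -
    have "p \<in> cball 0 (R + 2)" "q \<in> cball 0 (R + 2)"
      using that \<open>x \<in> cball 0 R\<close> \<epsilon>(2) dist_triangle[of 0 p x] dist_triangle[of 0 q x] by auto
    moreover have "dist p y < d1" "dist q z < d2"
      using that yz_x \<epsilon>(3,4) dist_triangle[of p y x] dist_triangle[of q z x]
      by (auto simp: dist_commute)
    ultimately have "dist (T p) (T y) < m / 2" "dist (V q) (V z) < m / 2"
      using d1(2) d2(2) yzR by auto
    then show ?thesis using m unfolding dist_real_def by linarith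
  qed
  \<comment> \<open>Outside \<Omega> the sum T + V vanishes, so a positive sum with p = q forces p
    into \<Omega>.\<close>
  have ball: "cball x (2 * \<epsilon>) \<subseteq> \<Omega>"
    using pos out by force
  have "x \<in> cball x (2 * \<epsilon>)" using \<epsilon> by simp
  obtain y0 where y0: "y0 \<in> cball x (2 * \<epsilon>)" "\<And>w. w \<in> cball x (2 * \<epsilon>) \<Longrightarrow> U y0 \<le> U w"
    using continuous_attains_inf[OF compact_cball _ continuous_on_subset[OF U(1)],
      of x "2 * \<epsilon>"] \<open>x \<in> cball x (2 * \<epsilon>)\<close> by blast
  define H where "H = h (U y0)"
  \<comment> \<open>Otherwise h(-V) \<le> H \<le> 0 wherever -V \<le> U y0, and the maximum
    principle gives V \<le> -U y0 everywhere, against positivity of T y0 + V x.\<close>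
  have "H > 0"
  proof (rule ccontr)
    assume "\<not> H > 0"
    have "V x \<le> - U y0"
    proof (rule radial_sub_le[OF \<Omega> V(1) _ V(2)])
      show "V w \<le> - U y0" if "w \<notin> \<Omega>" for w
        using V(3)[OF that] Uc[of y0] by simp
      show "- h (- V w) \<ge> 0" if "- U y0 \<le> V w" for w
        using h_mono[OF S(4)[of w] S(3)[of y0]] that \<open>\<not> H > 0\<close> by (simp add: H_def)
    qed
    moreover have "T y0 + V x > 0"
      by (rule pos[OF y0(1) \<open>x \<in> cball x (2 * \<epsilon>)\<close>])
    ultimately show False using TU[of y0] by simp
  qed
  define k where "k = root 3 (81 / 64 * H)"
  have "k > 0" using \<open>H > 0\<close> by (simp add: k_def)
  have k3: "64 / 81 * k ^ 3 = H" by (simp add: k_def odd_real_root_pow)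
  \<comment> \<open>A and B split the gap between k and \<mu> k: on the ball, k bounds the
    right-hand side for -V from above and \<mu> k bounds that for T from below, after cubing and
    multiplying by 64/81.\<close>
  define A B where "A = k * (1 + 2 / 3 * \<eta>)" and "B = k * (1 + 1 / 3 * \<eta>)"
  have AB: "k < B" "B < A" "A < \<mu> * k"
    using \<open>k > 0\<close> \<open>\<eta> > 0\<close> by (simp_all add: A_def B_def \<mu>_def algebra_simps)
  have "0 < B" "0 < A" using AB \<open>k > 0\<close> by linarith+
  have A3: "64 / 81 * A ^ 3 < \<mu> ^ 3 * H"
  proof -
    have "A ^ 3 < (\<mu> * k) ^ 3" using AB \<open>0 < A\<close> by (intro power_strict_mono) auto
    then show ?thesis by (simp add: k3[symmetric] power_mult_distrib)
  qed
  have B3: "H < 64 / 81 * B ^ 3"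
  proof -
    have "k ^ 3 < B ^ 3" using AB \<open>k > 0\<close> by (intro power_strict_mono) auto
    then show ?thesis by (simp add: k3[symmetric])
  qed
  show False
  proof (rule radial_sub_no_doubled_max[OF subT contT V(2,1) \<open>0 < B\<close> \<open>B < A\<close> \<open>\<epsilon> > 0\<close> ball])
    fix p assume "p \<in> ball x (2 * \<epsilon>)"
    then have p: "p \<in> cball x (2 * \<epsilon>)" by simp
    have "H \<le> h (U p)"
      unfolding H_def by (rule h_mono[OF S(3) S(3) y0(2)[OF p]])
    then have "\<mu> ^ 3 * H \<le> \<mu> ^ 3 * h (U p)"
      using \<open>\<mu> > 0\<close> by (intro mult_left_mono) auto
    moreover have "(T p - b) / \<mu> = U p" using \<open>\<mu> > 0\<close> by (simp add: T_def)
    ultimately show "64 / 81 * A ^ 3 < \<mu> ^ 3 * h ((T p - b) / \<mu>)"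
      using A3 by simp
    have "- V p \<le> U y0" using pos[OF y0(1) p] TU[of y0] by simp
    then have "h (- V p) \<le> H"
      unfolding H_def by (rule h_mono[OF S(4) S(3)])
    then show "- (64 / 81 * B ^ 3) < - h (- V p)" using B3 by simp
  next
    fix p assume p: "p \<in> cball x (2 * \<epsilon>)"
    then have "p \<in> cball 0 R" using ball R by blast
    then have "(p, x) \<in> C" "(x, p) \<in> C"
      using p \<open>x \<in> cball 0 R\<close> by (auto simp: C_def dist_commute)
    then show "T p + V x \<le> T y + V z" "T x + V p \<le> T y + V z"
      using yz(2) by auto
  qed (use yz_x in auto)
qed

text \<open>If h c < 0, the roles of U and V are exchanged: h becomes -h(-t), c becomes -c, and the
  new right-hand side is positive at -c.\<close>

lemma radial_sub_add_nonpos: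
  fixes \<Omega> :: "(real ^ 'n) set"
  assumes \<Omega>: "open \<Omega>" "bounded \<Omega>"
    and U: "continuous_on UNIV U" "radial_sub h \<Omega> U" "\<And>x. x \<notin> \<Omega> \<Longrightarrow> U x = c"
    and V: "continuous_on UNIV V" "radial_sub (\<lambda>t. - h (- t)) \<Omega> V" "\<And>x. x \<notin> \<Omega> \<Longrightarrow> V x = - c"
    and S: "mono_on S h" "c \<in> S" "\<And>x. U x \<in> S" "\<And>x. - V x \<in> S"
  shows "U x + V x \<le> 0"
proof (cases "h c \<ge> 0")
  case True
  with assms show ?thesis by (intro radial_sub_add_nonpos_aux[of \<Omega> U h c V S])
next
  case False
  have "V x + U x \<le> 0"
  proof (rule radial_sub_add_nonpos_aux[OF \<Omega> V, where S = "uminus ` S"])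
    show "mono_on (uminus ` S) (\<lambda>t. - h (- t))"
      using S(1) by (auto simp: mono_on_def)
    show "V y \<in> uminus ` S" "- U y \<in> uminus ` S" for y
      using S by (auto intro: rev_image_eqI[of "- V y"])
  qed (use U S False in auto)
  then show ?thesis by simp
qed

section \<open>From the Dirichlet problem to uniqueness\<close>

lemma radial_sub_cong:
  assumes "\<And>x. x \<in> \<Omega> \<Longrightarrow> W x = W' x" and sub: "radial_sub h \<Omega> W"
  shows "radial_sub h \<Omega> W'"
proof -
  have "local_max_in \<Omega> (\<lambda>x. W x - p x) x0" "W x0 = W' x0"
    if "local_max_in \<Omega> (\<lambda>x. W' x - p x) x0" for p x0
    using that assms(1) unfolding local_max_in_def
    by (auto simp: eventually_at_filter elim!: eventually_mono)
  note * = this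
  show ?thesis
    unfolding radial_sub_def
  proof (intro allI impI)
    fix x0 a \<kappa> \<sigma> \<tau>
    assume "\<bar>\<sigma>\<bar> = 1" "a \<noteq> x0" "0 < \<sigma> * dist x0 a + \<tau>"
      and lm: "local_max_in \<Omega> (\<lambda>x. W' x - \<kappa> * (\<sigma> * dist x a + \<tau>) powr (4/3)) x0"
    then have "h (W x0) \<le> 64 / 81 * \<kappa> ^ 3"
      using sub *(1)[OF lm] unfolding radial_sub_def by blast
    then show "h (W' x0) \<le> 64 / 81 * \<kappa> ^ 3"
      by (simp add: *(2)[OF lm])
  qed
qed

text \<open>Extension by the boundary value gives a function continuous on the whole space, as the
  comparison requires. The reflected function is the transform of -u under the odd reflection of
  \<Phi>, whose derivative E(-t) solves the equation with coefficient -g(-t).\<close>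

lemma dirichlet_viscosity_solution_radial_sub:
  fixes \<Omega> :: "(real ^ 'n) set"
  assumes sol: "dirichlet_viscosity_solution g f c \<Omega> u" and "open \<Omega>"
    and \<Phi>: "\<And>t. (\<Phi> has_real_derivative E t) (at t)"
    and E: "\<And>t. (E has_real_derivative g t * E t) (at t)" and Epos: "\<And>t. E t > 0"
    and h: "\<And>t. h (\<Phi> t) = - f t * E t ^ 3"
    and U_def: "U = (\<lambda>x. if x \<in> \<Omega> then \<Phi> (u x) else \<Phi> c)"
  shows "continuous_on UNIV U" "radial_sub h \<Omega> U" "radial_sub (\<lambda>t. - h (- t)) \<Omega> (\<lambda>x. - U x)"
proof -
  have cu: "continuous_on (closure \<Omega>) u" and bd: "\<And>x. x \<in> frontier \<Omega> \<Longrightarrow> u x = c"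
    using sol by (auto simp: dirichlet_viscosity_solution_def)
  have "continuous_on UNIV \<Phi>"
    using \<Phi> by (intro continuous_at_imp_continuous_on ballI DERIV_isCont)
  then have "continuous_on (closure \<Omega>) (\<lambda>x. \<Phi> (u x))"
    by (rule continuous_on_compose2[OF _ cu]) simp
  moreover have "U x = \<Phi> (u x)" if "x \<in> closure \<Omega>" for x
    using that bd \<open>open \<Omega>\<close> by (auto simp: U_def frontier_def interior_open)
  ultimately have "continuous_on (closure \<Omega>) U"
    by (simp cong: continuous_on_cong)
  moreover have "continuous_on (- \<Omega>) U"
    by (rule continuous_on_eq[OF continuous_on_const[of _ "\<Phi> c"]]) (simp add: U_def)
  ultimately have "continuous_on (closure \<Omega> \<union> - \<Omega>) U"
    using \<open>open \<Omega>\<close> by (intro continuous_on_closed_Un) auto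
  moreover have "closure \<Omega> \<union> - \<Omega> = UNIV"
    using closure_subset by blast
  ultimately show "continuous_on UNIV U" by simp
  have "radial_sub h \<Omega> (\<lambda>x. \<Phi> (u x))"
    using sol \<Phi> E Epos h
    by (intro viscosity_subsolution_radial_sub) (auto simp: dirichlet_viscosity_solution_def)
  then show "radial_sub h \<Omega> U"
    by (rule radial_sub_cong[rotated]) (simp add: U_def)
  have "radial_sub (\<lambda>t. - h (- t)) \<Omega> (\<lambda>x. (\<lambda>t. - \<Phi> (- t)) (- u x))"
  proof (rule viscosity_subsolution_radial_sub[where E = "\<lambda>t. E (- t)"
        and g = "\<lambda>t. - g (- t)" and f = "\<lambda>t. - f (- t)" and \<Phi> = "\<lambda>t. - \<Phi> (- t)"])
    show "viscosity_subsolution (\<lambda>t. - g (- t)) (\<lambda>t. - f (- t)) \<Omega> (\<lambda>x. - u x)"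
      using sol \<open>open \<Omega>\<close>
      by (intro viscosity_supersolution_uminus) (auto simp: dirichlet_viscosity_solution_def)
    show "((\<lambda>t. - \<Phi> (- t)) has_real_derivative E (- t)) (at t)" for t
      by (auto intro!: derivative_eq_intros DERIV_chain2[OF \<Phi>])
    show "((\<lambda>t. E (- t)) has_real_derivative - g (- t) * E (- t)) (at t)" for t
      using DERIV_chain2[OF E DERIV_minus[OF DERIV_ident]] by simp
  qed (auto simp: h Epos)
  then show "radial_sub (\<lambda>t. - h (- t)) \<Omega> (\<lambda>x. - U x)"
    by (rule radial_sub_cong[rotated]) (simp add: U_def)
qed

lemma primitive0_has_real_derivative:
  assumes "continuous_on UNIV g"
  shows "(primitive0 g has_real_derivative g t) (at t)"
proof -
  \<comment> \<open>The interval has 0 and t in its interior, so the derivative within it is the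
    full derivative.\<close>
  define a b where "a = min 0 t - 1" and "b = max 0 t + 1"
  have "((\<lambda>u. LBINT y=ereal 0..ereal u. g y) has_vector_derivative g t) (at t within {a..b})"
    by (rule interval_integral_FTC2[of a 0 b])
      (auto simp: a_def b_def intro: continuous_on_subset[OF assms])
  moreover have "primitive0 g = (\<lambda>u. LBINT y=ereal 0..ereal u. g y)"
    by (rule ext) (simp only: primitive0_def)
  moreover have "at t within {a..b} = at t"
    by (rule at_within_interior) (auto simp: a_def b_def)
  ultimately show ?thesis
    by (simp only: has_real_derivative_iff_has_vector_derivative)
qed

theorem theorem5:
  fixes \<Omega> :: "(real ^ 'n) set" and g f :: "real \<Rightarrow> real" and c :: real
    and u v :: "real ^ 'n \<Rightarrow> real"
  assumes "CARD('n) \<ge> 2"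
    and "open \<Omega>" and "connected \<Omega>" and "\<Omega> \<noteq> {}" and "bounded \<Omega>"
    and "continuous_on UNIV g"
    and "\<exists>s0\<ge>0. (\<forall>t\<ge>s0. g t \<ge> 0) \<and> (\<forall>t\<le>-s0. g t \<le> 0)"
    and "continuous_on UNIV f"
    and "antimono (\<lambda>t. f t * exp (3 * primitive0 g t))"
    and "dirichlet_viscosity_solution g f c \<Omega> u"
    and "dirichlet_viscosity_solution g f c \<Omega> v"
  shows "\<forall>x\<in>closure \<Omega>. u x = v x"
proof -
  define E where "E = (\<lambda>t. exp (primitive0 g t))"
  define \<Phi> where "\<Phi> = primitive0 E"
  have DE: "(E has_real_derivative g t * E t) (at t)" for t
    unfolding E_def
    by (auto intro!: derivative_eq_intros primitive0_has_real_derivative[OF \<open>continuous_on UNIV g\<close>])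
  then have "continuous_on UNIV E"
    by (intro continuous_at_imp_continuous_on ballI DERIV_isCont)
  then have D\<Phi>: "(\<Phi> has_real_derivative E t) (at t)" for t
    unfolding \<Phi>_def by (rule primitive0_has_real_derivative)
  have Epos: "E t > 0" for t by (simp add: E_def)
  have "strict_mono \<Phi>"
  proof (rule strict_monoI)
    show "\<Phi> s < \<Phi> t" if "s < t" for s t
      by (rule DERIV_pos_imp_increasing[OF that]) (use D\<Phi> Epos in blast)
  qed
  then have "inj \<Phi>" by (rule strict_mono_imp_inj_on)
  define h where "h = (\<lambda>s. - f (inv \<Phi> s) * E (inv \<Phi> s) ^ 3)"
  have h: "h (\<Phi> t) = - f t * E t ^ 3" for t
    using \<open>inj \<Phi>\<close> by (simp add: h_def)
  \<comment> \<open>Since E^3 = exp (3 G), the monotonicity assumption on \<open>f\<close> says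
    exactly that h increases weakly along \<Phi>.\<close>
  have h': "h (\<Phi> t) = - (f t * exp (3 * primitive0 g t))" for t
    using exp_of_nat_mult[of 3 "primitive0 g t"] by (simp add: h E_def)
  have mono: "mono_on (range \<Phi>) h"
    using \<open>antimono _\<close> strict_mono_less_eq[OF \<open>strict_mono \<Phi>\<close>]
    by (auto simp: mono_on_def h' monotone_on_def)
  define ext where "ext = (\<lambda>u x. if x \<in> \<Omega> then \<Phi> (u x) else \<Phi> c)"
  have ext: "ext w = (\<lambda>x. if x \<in> \<Omega> then \<Phi> (w x) else \<Phi> c)" for w
    by (simp add: ext_def)
  have le: "ext w x + - ext w' x \<le> 0"
    if w: "dirichlet_viscosity_solution g f c \<Omega> w"
      and w': "dirichlet_viscosity_solution g f c \<Omega> w'" for w w' x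
  proof (rule radial_sub_add_nonpos[OF \<open>open \<Omega>\<close> \<open>bounded \<Omega>\<close>, where U = "ext w" and V = "\<lambda>x. - ext w' x"])
    note rw = dirichlet_viscosity_solution_radial_sub[OF w \<open>open \<Omega>\<close> D\<Phi> DE Epos h ext]
    note rw' = dirichlet_viscosity_solution_radial_sub[OF w' \<open>open \<Omega>\<close> D\<Phi> DE Epos h ext]
    show "continuous_on UNIV (ext w)" by (rule rw(1))
    show "radial_sub h \<Omega> (ext w)" by (rule rw(2))
    show "radial_sub (\<lambda>t. - h (- t)) \<Omega> (\<lambda>x. - ext w' x)" by (rule rw'(3))
    show "continuous_on UNIV (\<lambda>x. - ext w' x)" by (rule continuous_on_minus[OF rw'(1)])
  qed (use mono in \<open>auto simp: ext_def\<close>)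
  \<comment> \<open>The comparison is applied in both orders.\<close>
  have eq: "ext u x = ext v x" for x
    using le[of u v x] le[of v u x] assms(10,11) by simp
  show ?thesis
  proof
    fix x assume x: "x \<in> closure \<Omega>"
    show "u x = v x"
    proof (cases "x \<in> \<Omega>")
      case True
      then show ?thesis using eq[of x] \<open>inj \<Phi>\<close> by (simp add: ext_def inj_eq)
    next
      case False
      then have "x \<in> frontier \<Omega>"
        using x \<open>open \<Omega>\<close> by (simp add: frontier_def interior_open)
      then show ?thesis
        using assms(10,11) by (simp add: dirichlet_viscosity_solution_def)
    qed
  qed
qed

end
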